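(* Let $(X,\kappa)$ and $(Y,\lambda)$ be digital images, $x_0\in X$, $y_0\in Y$, and suppose $(X,x_0)$ and $(Y,y_0)$ have the same pointed long homotopy type, $(X,x_0)\simeq^{L}_{\kappa,\lambda}(Y,y_0)$. Then the groups $\Pi_1^{\kappa}(X,x_0)$ and $\Pi_1^{\lambda}(Y,y_0)$ are isomorphic.
   Context: A digital image $(X,\kappa)$ is a set $X\subset\mathbb Z^n$ (for some $n\ge 1$) with an adjacency relation $\kappa$ (a symmetric, irreflexive relation). A subset is $\kappa$-connected if any two distinct points of it are joined by a finite sequence of points of the subset whose consecutive members are $\kappa$-adjacent. A function $f:(X,\kappa)\to(Y,\lambda)$ is $(\kappa,\lambda)$-continuous if it maps $\kappa$-connected sets to $\lambda$-connected sets; equivalently, $\kappa$-adjacent points are mapped to equal or $\lambda$-adjacent points. $\mathbb N=\{1,2,\dots\}$, $\mathbb N^*=\{0\}\cup\mathbb N$, $[a,b]_{\mathbb Z}=\{z\in\mathbb Z: a\le z\le b\}$; subsets of $\mathbb Z$ carry the adjacency in which consecutive integers are adjacent. Long homotopy: for continuous $f,g:(X,\kappa)\to(Y,\lambda)$, a long homotopy from $f$ to $g$ is $F:X\times\mathbb Z\to Y$ such that for each $x\in X$ there is $N_{F,x}\in\mathbb N$ with $F(x,t)=f(x)$ for $t\le -N_{F,x}$ and $F(x,t)=g(x)$ for $t\ge N_{F,x}$; for each $x\in X$ the function $t\mapsto F(x,t)$ is continuous on $\mathbb Z$; and for each $t\in\mathbb Z$ the function $x\mapsto F(x,t)$ is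 $(\kappa,\lambda)$-continuous. Then $f\simeq^L g$. It is pointed with respect to $x_0\in X$, $y_0\in Y$ if $F(x_0,t)=y_0$ for all $t\in\mathbb Z$. $(X,x_0)\simeq^L_{\kappa,\lambda}(Y,y_0)$ (same pointed long homotopy type) means there are continuous $f:X\to Y$, $g:Y\to X$ with $f(x_0)=y_0$, $g(y_0)=x_0$, and long homotopies $g\circ f\simeq^L 1_X$ holding $x_0$ fixed and $f\circ g\simeq^L1_Y$ holding $y_0$ fixed. Homotopy (used for the fundamental group): continuous $f,g:(X,\kappa)\to(Y,\lambda)$ are homotopic if there are a positive integer $m$ and $F:X\times[0,m]_{\mathbb Z}\to Y$ with $F(x,0)=f(x)$, $F(x,m)=g(x)$, continuous in $t$ for each $x$ and in $x$ for each $t$. Fundamental group: an EC path in $X$ is a continuous $f:\mathbb N^*\to X$ that is eventually constant, with eventual value $f(\infty)$; it is an EC loop based at $f(0)$ if $f(0)=f(\infty)$. An EC homotopy between EC paths $f,g$ is a homotopy $H:[0,k]_{\mathbb Z}\times\mathbb N^*\to X$ ($[0,k]_{\mathbb Z}$ is the homotopy parameter) from $f$ to $g$ such that every $H_s(t)=H(s,t)$ is an EC path; it holds the endpoints fixed if $H_s(0)=f(0)=g(0)$ for all $s$ and there is $c\in\mathbb N$ with $H_s(n)=f(n)=g(n)$ for all $n\ge c$ and all $s$. For an EC loop $f$, $N_f=\min\{m\in\mathbb N^*: f(n)=f(m)\text{ for all }n\ge m\}$. For $x_0$-based EC loops, $(f_0*f_1)(n)=f_0(n)$ if $0\le n\le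 N_{f_0}$ and $f_1(n-N_{f_0})$ if $n\ge N_{f_0}$. $\Pi_1^\kappa(X,x_0)$ is the set of classes $[f]$ of $x_0$-based EC loops under EC homotopy holding the endpoints fixed, a group under $[f]\cdot[g]=[f*g]$. *)

theory Defs
  imports "HOL-Analysis.Finite_Cartesian_Product" "HOL-Algebra.Group"
begin

section \<open>Digital images and continuity\<close>

text \<open>
  Adjacencies are binary predicates. Only their restriction to the underlying set matters;
  likewise a map \<open>X \<rightarrow> Y\<close> is a total HOL function of which only the values on \<open>X\<close> matter.
  Except for \<open>digital_image\<close>, the notions below are polymorphic, so that they also cover
  subsets of the integers with the consecutive-integer adjacency.
\<close>

definition digital_image :: "(int ^ 'n::finite) set \<Rightarrow> (int ^ 'n \<Rightarrow> int ^ 'n \<Rightarrow> bool) \<Rightarrow> bool" where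
  "digital_image X \<kappa> \<longleftrightarrow> symp_on X \<kappa> \<and> irreflp_on X \<kappa>"

text \<open>Used at type \<open>int\<close>, and at type \<open>nat\<close> for the nonnegative integers.\<close>

definition consec :: "'a::{plus,one} \<Rightarrow> 'a \<Rightarrow> bool" where
  "consec a b \<longleftrightarrow> b = a + 1 \<or> a = b + 1"

definition adj_connected :: "('a \<Rightarrow> 'a \<Rightarrow> bool) \<Rightarrow> 'a set \<Rightarrow> bool" where
  "adj_connected \<kappa> A \<longleftrightarrow>
     (\<forall>x\<in>A. \<forall>y\<in>A. x \<noteq> y \<longrightarrow>
        (\<exists>p. p \<noteq> [] \<and> set p \<subseteq> A \<and> hd p = x \<and> last p = y \<and> successively \<kappa> p))"

definition dig_continuous ::
  "'a set \<Rightarrow> ('a \<Rightarrow> 'a \<Rightarrow> bool) \<Rightarrow> 'b set \<Rightarrow> ('b \<Rightarrow> 'b \<Rightarrow> bool) \<Rightarrow> ('a \<Rightarrow> 'b) \<Rightarrow> bool" where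
  "dig_continuous X \<kappa> Y lam f \<longleftrightarrow>
     f \<in> X \<rightarrow> Y \<and> (\<forall>A\<subseteq>X. adj_connected \<kappa> A \<longrightarrow> adj_connected lam (f ` A))"


section \<open>Long homotopies\<close>

definition long_homotopy ::
  "'a set \<Rightarrow> ('a \<Rightarrow> 'a \<Rightarrow> bool) \<Rightarrow> 'b set \<Rightarrow> ('b \<Rightarrow> 'b \<Rightarrow> bool) \<Rightarrow>
    ('a \<Rightarrow> 'b) \<Rightarrow> ('a \<Rightarrow> 'b) \<Rightarrow> ('a \<Rightarrow> int \<Rightarrow> 'b) \<Rightarrow> bool" where
  "long_homotopy X \<kappa> Y lam f g F \<longleftrightarrow>
     dig_continuous X \<kappa> Y lam f \<and> dig_continuous X \<kappa> Y lam g \<and>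
     (\<forall>x\<in>X. \<exists>N::nat. N > 0 \<and> (\<forall>t \<le> - int N. F x t = f x) \<and> (\<forall>t \<ge> int N. F x t = g x)) \<and>
     (\<forall>x\<in>X. dig_continuous UNIV consec Y lam (F x)) \<and>
     (\<forall>t. dig_continuous X \<kappa> Y lam (\<lambda>x. F x t))"

definition pointed_long_homotopic ::
  "'a set \<Rightarrow> ('a \<Rightarrow> 'a \<Rightarrow> bool) \<Rightarrow> 'a \<Rightarrow> 'b set \<Rightarrow> ('b \<Rightarrow> 'b \<Rightarrow> bool) \<Rightarrow> 'b \<Rightarrow>
    ('a \<Rightarrow> 'b) \<Rightarrow> ('a \<Rightarrow> 'b) \<Rightarrow> bool" where
  "pointed_long_homotopic X \<kappa> x0 Y lam y0 f g \<longleftrightarrow>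
     (\<exists>F. long_homotopy X \<kappa> Y lam f g F \<and> (\<forall>t. F x0 t = y0))"

definition same_pointed_long_homotopy_type ::
  "'a set \<Rightarrow> ('a \<Rightarrow> 'a \<Rightarrow> bool) \<Rightarrow> 'a \<Rightarrow> 'b set \<Rightarrow> ('b \<Rightarrow> 'b \<Rightarrow> bool) \<Rightarrow> 'b \<Rightarrow> bool" where
  "same_pointed_long_homotopy_type X \<kappa> x0 Y lam y0 \<longleftrightarrow>
     (\<exists>f g. dig_continuous X \<kappa> Y lam f \<and> dig_continuous Y lam X \<kappa> g \<and>
        f x0 = y0 \<and> g y0 = x0 \<and>
        pointed_long_homotopic X \<kappa> x0 X \<kappa> x0 (g \<circ> f) id \<and>
        pointed_long_homotopic Y lam y0 Y lam y0 (f \<circ> g) id)"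


section \<open>The fundamental group via eventually constant loops\<close>

definition dig_homotopy ::
  "'a set \<Rightarrow> ('a \<Rightarrow> 'a \<Rightarrow> bool) \<Rightarrow> 'b set \<Rightarrow> ('b \<Rightarrow> 'b \<Rightarrow> bool) \<Rightarrow>
    ('a \<Rightarrow> 'b) \<Rightarrow> ('a \<Rightarrow> 'b) \<Rightarrow> nat \<Rightarrow> ('a \<Rightarrow> nat \<Rightarrow> 'b) \<Rightarrow> bool" where
  "dig_homotopy X \<kappa> Y lam f g m F \<longleftrightarrow>
     dig_continuous X \<kappa> Y lam f \<and> dig_continuous X \<kappa> Y lam g \<and> m > 0 \<and>
     (\<forall>x\<in>X. F x 0 = f x \<and> F x m = g x) \<and>
     (\<forall>x\<in>X. dig_continuous {0..m} consec Y lam (F x)) \<and>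
     (\<forall>t\<in>{0..m}. dig_continuous X \<kappa> Y lam (\<lambda>x. F x t))"

definition ec_path :: "'a set \<Rightarrow> ('a \<Rightarrow> 'a \<Rightarrow> bool) \<Rightarrow> (nat \<Rightarrow> 'a) \<Rightarrow> bool" where
  "ec_path X \<kappa> f \<longleftrightarrow>
     dig_continuous UNIV consec X \<kappa> f \<and> (\<exists>c. \<forall>\<^sub>F n in sequentially. f n = c)"

definition ec_end :: "(nat \<Rightarrow> 'a) \<Rightarrow> 'a" where
  "ec_end f = (THE c. \<forall>\<^sub>F n in sequentially. f n = c)"

definition ec_loops :: "'a set \<Rightarrow> ('a \<Rightarrow> 'a \<Rightarrow> bool) \<Rightarrow> 'a \<Rightarrow> (nat \<Rightarrow> 'a) set" where
  "ec_loops X \<kappa> x0 = {f. ec_path X \<kappa> f \<and> f 0 = x0 \<and> ec_end f = x0}"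

text \<open>Here the homotopy parameter is the first argument of \<open>H\<close>.\<close>

definition ec_homotopy ::
  "'a set \<Rightarrow> ('a \<Rightarrow> 'a \<Rightarrow> bool) \<Rightarrow> (nat \<Rightarrow> 'a) \<Rightarrow> (nat \<Rightarrow> 'a) \<Rightarrow>
    nat \<Rightarrow> (nat \<Rightarrow> nat \<Rightarrow> 'a) \<Rightarrow> bool" where
  "ec_homotopy X \<kappa> f g k H \<longleftrightarrow>
     dig_homotopy UNIV consec X \<kappa> f g k (\<lambda>n s. H s n) \<and> (\<forall>s\<in>{0..k}. ec_path X \<kappa> (H s))"

definition holds_endpoints_fixed ::
  "(nat \<Rightarrow> 'a) \<Rightarrow> (nat \<Rightarrow> 'a) \<Rightarrow> nat \<Rightarrow> (nat \<Rightarrow> nat \<Rightarrow> 'a) \<Rightarrow> bool" where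
  "holds_endpoints_fixed f g k H \<longleftrightarrow>
     (\<forall>s\<in>{0..k}. H s 0 = f 0 \<and> f 0 = g 0) \<and>
     (\<exists>c>0. \<forall>n\<ge>c. \<forall>s\<in>{0..k}. H s n = f n \<and> f n = g n)"

definition ec_loop_rel ::
  "'a set \<Rightarrow> ('a \<Rightarrow> 'a \<Rightarrow> bool) \<Rightarrow> 'a \<Rightarrow> ((nat \<Rightarrow> 'a) \<times> (nat \<Rightarrow> 'a)) set" where
  "ec_loop_rel X \<kappa> x0 =
     {(f, g). f \<in> ec_loops X \<kappa> x0 \<and> g \<in> ec_loops X \<kappa> x0 \<and>
        (\<exists>k H. ec_homotopy X \<kappa> f g k H \<and> holds_endpoints_fixed f g k H)}"

definition ec_stop :: "(nat \<Rightarrow> 'a) \<Rightarrow> nat" where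
  "ec_stop f = (LEAST m. \<forall>n\<ge>m. f n = f m)"

definition ec_concat :: "(nat \<Rightarrow> 'a) \<Rightarrow> (nat \<Rightarrow> 'a) \<Rightarrow> nat \<Rightarrow> 'a" where
  "ec_concat f g n = (if n \<le> ec_stop f then f n else g (n - ec_stop f))"

text \<open>
  The product of two classes is the union of the classes of all products of representatives;
  it is a single class because concatenation respects \<open>ec_loop_rel\<close>.
\<close>

definition ec_fundamental_group ::
  "'a set \<Rightarrow> ('a \<Rightarrow> 'a \<Rightarrow> bool) \<Rightarrow> 'a \<Rightarrow> (nat \<Rightarrow> 'a) set monoid" where
  "ec_fundamental_group X \<kappa> x0 =
     \<lparr>carrier = ec_loops X \<kappa> x0 // ec_loop_rel X \<kappa> x0,
      monoid.mult = (\<lambda>A B. \<Union>f\<in>A. \<Union>g\<in>B. ec_loop_rel X \<kappa> x0 `` {ec_concat f g}),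
      one = ec_loop_rel X \<kappa> x0 `` {\<lambda>_. x0}\<rparr>"

end

theory Submission
  imports Defs
begin

text \<open>
  An EC homotopy between loops that holds the endpoints fixed is a finite chain of loops in which
  neighbours are pointwise equal or adjacent. An EC loop takes finitely many values, so along it the
  bounds of a long homotopy can be chosen uniformly and the long homotopy becomes such a chain;
  hence the two maps induce mutually inverse maps on classes. They are multiplicative because
  waiting one time step longer before the second loop changes a concatenation by a single link.
\<close>

section \<open>Connectedness and continuity as conditions on adjacent points\<close>

text \<open>Reading a path as a reflexive transitive closure allows induction along it. The case of
  two equal points, which the definition leaves out, is absorbed by reflexivity.\<close>

lemma adj_connected_iff:
  "adj_connected \<kappa> A \<longleftrightarrow>
     (\<forall>x\<in>A. \<forall>y\<in>A. (\<lambda>u v. u \<in> A \<and> v \<in> A \<and> \<kappa> u v)\<^sup>*\<^sup>* x y)" (is "_ \<longleftrightarrow> (\<forall>x\<in>A. \<forall>y\<in>A. ?R\<^sup>*\<^sup>* x y)")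
proof -
  have path: "?R\<^sup>*\<^sup>* (hd p) (last p)" if "p \<noteq> []" "set p \<subseteq> A" "successively \<kappa> p" for p
    using that
  proof (induction p rule: induct_list012)
    case (3 x y zs)
    then have "?R x y" "?R\<^sup>*\<^sup>* y (last (y # zs))"
      by auto
    then have "?R\<^sup>*\<^sup>* x (last (y # zs))"
      by (rule converse_rtranclp_into_rtranclp)
    then show ?case
      by simp
  qed auto
  have list: "\<exists>p. p \<noteq> [] \<and> set p \<subseteq> A \<and> hd p = x \<and> last p = y \<and> successively \<kappa> p"
    if "?R\<^sup>*\<^sup>* x y" "y \<in> A" for x y
    using that
  proof (induction rule: converse_rtranclp_induct)
    case base
    then show ?case
      by (intro exI[of _ "[y]"]) auto
  next
    case (step u v)
    then obtain p where "p \<noteq> []" "set p \<subseteq> A" "hd p = v" "last p = y" "successively \<kappa> p"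
      by auto
    with step.hyps show ?case
      by (intro exI[of _ "u # p"]) (auto simp: successively_Cons)
  qed
  show ?thesis
    unfolding adj_connected_def
  proof (intro iffI ballI impI)
    fix x y
    assume *: "\<forall>x\<in>A. \<forall>y\<in>A. x \<noteq> y \<longrightarrow>
        (\<exists>p. p \<noteq> [] \<and> set p \<subseteq> A \<and> hd p = x \<and> last p = y \<and> successively \<kappa> p)"
      and xy: "x \<in> A" "y \<in> A"
    show "?R\<^sup>*\<^sup>* x y"
    proof (cases "x = y")
      case False
      with * xy obtain p
        where "p \<noteq> []" "set p \<subseteq> A" "hd p = x" "last p = y" "successively \<kappa> p"
        by blast
      with path[of p] show ?thesis
        by simp
    qed simp
  qed (use list in blast)
qed

lemma dig_continuous_iff:
  assumes "symp_on X \<kappa>"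
  shows "dig_continuous X \<kappa> Y lam f \<longleftrightarrow>
     (\<forall>x\<in>X. f x \<in> Y) \<and> (\<forall>x\<in>X. \<forall>y\<in>X. \<kappa> x y \<longrightarrow> lam\<^sup>=\<^sup>= (f x) (f y))"
proof (intro iffI conjI ballI impI)
  assume *: "dig_continuous X \<kappa> Y lam f"
  then show "f x \<in> Y" if "x \<in> X" for x
    using that by (auto simp: dig_continuous_def)
  fix x y assume xy: "x \<in> X" "y \<in> X" "\<kappa> x y"
  then have "\<kappa> y x"
    using symp_onD[OF assms] by blast
  with xy have "adj_connected \<kappa> {x, y}"
    by (auto simp: adj_connected_iff intro: r_into_rtranclp)
  with * xy have "adj_connected lam {f x, f y}"
    by (auto simp: dig_continuous_def dest!: spec[of _ "{x, y}"])
  then have "(\<lambda>u v. u \<in> {f x, f y} \<and> v \<in> {f x, f y} \<and> lam u v)\<^sup>*\<^sup>* (f x) (f y)"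
    unfolding adj_connected_iff by blast
  \<comment> \<open>A link ending in \<open>f y\<close> starts in \<open>f x\<close> or in
    \<open>f y\<close>; in the second case the shorter path already gives the claim.\<close>
  then show "lam\<^sup>=\<^sup>= (f x) (f y)"
    by (induction rule: rtranclp_induct) auto
next
  assume *: "(\<forall>x\<in>X. f x \<in> Y) \<and> (\<forall>x\<in>X. \<forall>y\<in>X. \<kappa> x y \<longrightarrow> lam\<^sup>=\<^sup>= (f x) (f y))"
  have "adj_connected lam (f ` A)" if A: "A \<subseteq> X" "adj_connected \<kappa> A" for A
  proof -
    have "(\<lambda>u v. u \<in> f ` A \<and> v \<in> f ` A \<and> lam u v)\<^sup>*\<^sup>* (f x) (f y)"
      if "(\<lambda>u v. u \<in> A \<and> v \<in> A \<and> \<kappa> u v)\<^sup>*\<^sup>* x y" for x y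
      using that
    proof (induction rule: rtranclp_induct)
      case (step u v)
      then have "lam\<^sup>=\<^sup>= (f u) (f v)"
        using * A by blast
      with step show ?case
        by (auto intro: rtranclp.rtrancl_into_rtrancl)
    qed simp
    with A show ?thesis
      unfolding adj_connected_iff by blast
  qed
  with * show "dig_continuous X \<kappa> Y lam f"
    by (auto simp: dig_continuous_def)
qed

lemma symp_on_consec: "symp_on A (consec :: 'a::{plus,one} \<Rightarrow> 'a \<Rightarrow> bool)"
  by (auto simp: symp_on_def consec_def)

lemma reflclp_sym:
  assumes "symp_on X \<kappa>" "x \<in> X" "y \<in> X" "\<kappa>\<^sup>=\<^sup>= x y"
  shows "\<kappa>\<^sup>=\<^sup>= y x"
  using assms(4) symp_onD[OF assms(1-3)] by auto

text \<open>Checking forward steps suffices, because symmetry of \<open>\<kappa>\<close> on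
  \<open>X\<close> reverses them.\<close>

lemma dig_continuous_nat_iff:
  assumes "symp_on X \<kappa>"
  shows "dig_continuous (UNIV :: nat set) consec X \<kappa> f \<longleftrightarrow>
    (\<forall>n. f n \<in> X) \<and> (\<forall>n. \<kappa>\<^sup>=\<^sup>= (f n) (f (Suc n)))"
proof -
  have *: "\<kappa>\<^sup>=\<^sup>= (f (Suc n)) (f n)" if "\<forall>n. f n \<in> X" "\<forall>n. \<kappa>\<^sup>=\<^sup>= (f n) (f (Suc n))" for n
    using that by - (rule reflclp_sym[OF assms], simp_all)
  show ?thesis
    unfolding dig_continuous_iff[OF symp_on_consec] consec_def
  proof (intro iffI conjI; elim conjE)
    assume "\<forall>n. f n \<in> X" "\<forall>n. \<kappa>\<^sup>=\<^sup>= (f n) (f (Suc n))"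
    then show "\<forall>x\<in>UNIV. \<forall>y\<in>UNIV. y = x + 1 \<or> x = y + 1 \<longrightarrow> \<kappa>\<^sup>=\<^sup>= (f x) (f y)"
      using * by (intro ballI impI; elim disjE; hypsubst; simp)
  qed auto
qed

lemma dig_continuous_atLeastAtMost_iff:
  assumes "symp_on X \<kappa>"
  shows "dig_continuous {0..m::nat} consec X \<kappa> f \<longleftrightarrow>
    (\<forall>n\<le>m. f n \<in> X) \<and> (\<forall>n<m. \<kappa>\<^sup>=\<^sup>= (f n) (f (Suc n)))"
proof -
  have *: "\<kappa>\<^sup>=\<^sup>= (f (Suc n)) (f n)"
    if "\<forall>n\<le>m. f n \<in> X" "\<forall>n<m. \<kappa>\<^sup>=\<^sup>= (f n) (f (Suc n))" "Suc n \<le> m" for n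
    using that by - (rule reflclp_sym[OF assms], simp_all)
  show ?thesis
    unfolding dig_continuous_iff[OF symp_on_consec] consec_def
  proof (intro iffI conjI; elim conjE)
    assume "\<forall>n\<le>m. f n \<in> X" "\<forall>n<m. \<kappa>\<^sup>=\<^sup>= (f n) (f (Suc n))"
    then show "\<forall>x\<in>{0..m}. \<forall>y\<in>{0..m}. y = x + 1 \<or> x = y + 1 \<longrightarrow> \<kappa>\<^sup>=\<^sup>= (f x) (f y)"
      using *[unfolded Suc_le_eq] by (intro ballI impI; elim disjE; hypsubst; simp)
  next
    assume **: "\<forall>x\<in>{0..m}. \<forall>y\<in>{0..m}. y = x + 1 \<or> x = y + 1 \<longrightarrow> \<kappa>\<^sup>=\<^sup>= (f x) (f y)"
    show "\<forall>n<m. \<kappa>\<^sup>=\<^sup>= (f n) (f (Suc n))"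
    proof (intro allI impI)
      fix n assume "n < m"
      then show "\<kappa>\<^sup>=\<^sup>= (f n) (f (Suc n))"
        using bspec[OF bspec[OF **, of n], of "Suc n"] by simp
    qed
  qed auto
qed

section \<open>Eventually constant loops\<close>

text \<open>Two eventual values agree at some common late index, so the definite description in
  \<open>ec_end\<close> is determined as soon as one eventual value exists.\<close>

lemma ec_end_eq_iff:
  assumes "\<exists>c. \<forall>\<^sub>F n in sequentially. f n = c"
  shows "ec_end f = x \<longleftrightarrow> (\<forall>\<^sub>F n in sequentially. f n = x)"
proof -
  have unique: "c = d"
    if "\<forall>\<^sub>F n in sequentially. f n = c" "\<forall>\<^sub>F n in sequentially. f n = d" for c d
  proof -
    from that have "\<forall>\<^sub>F n in sequentially. c = d"
      by eventually_elim simp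
    then show ?thesis
      by simp
  qed
  obtain c where c: "\<forall>\<^sub>F n in sequentially. f n = c"
    using assms by blast
  then have "ec_end f = c"
    unfolding ec_end_def using unique by (intro the_equality) auto
  with c unique show ?thesis
    by blast
qed

lemma ec_loops_iff:
  assumes "symp_on X \<kappa>"
  shows "f \<in> ec_loops X \<kappa> x0 \<longleftrightarrow>
    (\<forall>n. f n \<in> X) \<and> (\<forall>n. \<kappa>\<^sup>=\<^sup>= (f n) (f (Suc n))) \<and> f 0 = x0 \<and> (\<exists>N. \<forall>n\<ge>N. f n = x0)"
proof (cases "\<exists>c. \<forall>\<^sub>F n in sequentially. f n = c")
  case True
  then have "ec_end f = x0 \<longleftrightarrow> (\<exists>N. \<forall>n\<ge>N. f n = x0)"
    by (simp add: ec_end_eq_iff eventually_sequentially)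
  with True show ?thesis
    unfolding ec_loops_def ec_path_def dig_continuous_nat_iff[OF assms] by blast
next
  case False
  then have "\<nexists>N. \<forall>n\<ge>N. f n = x0"
    unfolding eventually_sequentially by blast
  with False show ?thesis
    unfolding ec_loops_def ec_path_def by blast
qed

lemma ec_loopsD:
  assumes "symp_on X \<kappa>" "f \<in> ec_loops X \<kappa> x0"
  shows "f n \<in> X" "\<kappa>\<^sup>=\<^sup>= (f n) (f (Suc n))" "f 0 = x0" "\<exists>N. \<forall>n\<ge>N. f n = x0"
  using assms(2) unfolding ec_loops_iff[OF assms(1)] by blast+

section \<open>Homotopies of loops as chains of links\<close>

text \<open>This is an endpoint-fixing EC homotopy of length one: since both maps are loops at
  \<open>x0\<close>, they agree at time 0 and from some time on.\<close>

definition loop_step ::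
  "'a set \<Rightarrow> ('a \<Rightarrow> 'a \<Rightarrow> bool) \<Rightarrow> 'a \<Rightarrow> (nat \<Rightarrow> 'a) \<Rightarrow> (nat \<Rightarrow> 'a) \<Rightarrow> bool" where
  "loop_step X \<kappa> x0 f g \<longleftrightarrow>
     f \<in> ec_loops X \<kappa> x0 \<and> g \<in> ec_loops X \<kappa> x0 \<and> (\<forall>n. \<kappa>\<^sup>=\<^sup>= (f n) (g n))"

lemma rtranclp_loop_step_in_loops:
  assumes "(loop_step X \<kappa> x0)\<^sup>*\<^sup>* f g" "f \<in> ec_loops X \<kappa> x0"
  shows "g \<in> ec_loops X \<kappa> x0"
  using assms by (induction rule: rtranclp_induct) (auto simp: loop_step_def)

lemma loop_step_chain:
  fixes H :: "nat \<Rightarrow> nat \<Rightarrow> 'a"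
  assumes "\<And>s. s \<le> k \<Longrightarrow> H s \<in> ec_loops X \<kappa> x0"
    and "\<And>s n. s < k \<Longrightarrow> \<kappa>\<^sup>=\<^sup>= (H s n) (H (Suc s) n)"
  shows "(loop_step X \<kappa> x0)\<^sup>*\<^sup>* (H 0) (H k)"
proof -
  have "(loop_step X \<kappa> x0)\<^sup>*\<^sup>* (H 0) (H j)" if "j \<le> k" for j
    using that
  proof (induction j)
    case (Suc j)
    then have "loop_step X \<kappa> x0 (H j) (H (Suc j))"
      using assms by (auto simp: loop_step_def)
    with Suc show ?case
      by (simp add: rtranclp.rtrancl_into_rtrancl)
  qed simp
  then show ?thesis
    by simp
qed

text \<open>The time slices of a homotopy are the members of a chain. Conversely a chain is glued to
  a homotopy, and finitely many loops have a common time after which all of them rest at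
  \<open>x0\<close>.\<close>

lemma ec_loop_rel_iff:
  assumes sym: "symp_on X \<kappa>"
  shows "(f, g) \<in> ec_loop_rel X \<kappa> x0 \<longleftrightarrow>
    f \<in> ec_loops X \<kappa> x0 \<and> (loop_step X \<kappa> x0)\<^sup>*\<^sup>* f g"
proof (intro iffI conjI; (elim conjE)?)
  assume "(f, g) \<in> ec_loop_rel X \<kappa> x0"
  then obtain k H where f: "f \<in> ec_loops X \<kappa> x0" and g: "g \<in> ec_loops X \<kappa> x0"
    and H: "dig_homotopy UNIV consec X \<kappa> f g k (\<lambda>n s. H s n)"
    and path: "\<And>s. s \<le> k \<Longrightarrow> ec_path X \<kappa> (H s)"
    and ends: "holds_endpoints_fixed f g k H"
    by (auto simp: ec_loop_rel_def ec_homotopy_def)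
  show "f \<in> ec_loops X \<kappa> x0"
    by fact
  obtain N where N: "\<And>n. n \<ge> N \<Longrightarrow> f n = x0" and f0: "f 0 = x0"
    using ec_loopsD(3,4)[OF sym f] by blast
  obtain c where "\<forall>n\<ge>c. \<forall>s\<in>{0..k}. H s n = f n \<and> f n = g n"
    using ends unfolding holds_endpoints_fixed_def by blast
  then have c: "H s n = f n" if "n \<ge> c" "s \<le> k" for n s
    using that by simp
  \<comment> \<open>Past both \<open>N\<close> and \<open>c\<close> each slice agrees with
    \<open>f\<close>, which then rests at \<open>x0\<close>.\<close>
  have "H s \<in> ec_loops X \<kappa> x0" if "s \<le> k" for s
  proof -
    have "H s n = x0" if "n \<ge> max N c" for n
      using that N c \<open>s \<le> k\<close> by simp
    moreover have "H s 0 = x0"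
      using ends f0 that unfolding holds_endpoints_fixed_def by simp
    ultimately show ?thesis
      using path[OF that] unfolding ec_loops_iff[OF sym] ec_path_def dig_continuous_nat_iff[OF sym]
      by blast
  qed
  moreover have "\<kappa>\<^sup>=\<^sup>= (H s n) (H (Suc s) n)" if "s < k" for s n
    using H that unfolding dig_homotopy_def dig_continuous_atLeastAtMost_iff[OF sym] by blast
  ultimately have "(loop_step X \<kappa> x0)\<^sup>*\<^sup>* (H 0) (H k)"
    by (rule loop_step_chain)
  moreover have "H 0 = f" "H k = g"
    using H unfolding dig_homotopy_def by auto
  ultimately show "(loop_step X \<kappa> x0)\<^sup>*\<^sup>* f g"
    by simp
next
  assume f: "f \<in> ec_loops X \<kappa> x0" and fg: "(loop_step X \<kappa> x0)\<^sup>*\<^sup>* f g"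
  have g: "g \<in> ec_loops X \<kappa> x0"
    using rtranclp_loop_step_in_loops[OF fg f] .
  obtain j where "(loop_step X \<kappa> x0 ^^ j) f g"
    using fg by (auto simp: rtranclp_power)
  \<comment> \<open>A homotopy must have positive length, so a trivial link is put in front; this
    covers the empty chain.\<close>
  moreover have "loop_step X \<kappa> x0 f f"
    using f by (simp add: loop_step_def)
  ultimately have "(loop_step X \<kappa> x0 ^^ Suc j) f g"
    by (metis relpowp_Suc_I2)
  then obtain k H where k: "k > 0" and H0: "H 0 = f" "H k = g"
    and step: "\<And>i. i < k \<Longrightarrow> loop_step X \<kappa> x0 (H i) (H (Suc i))"
    unfolding relpowp_fun_conv by (metis zero_less_Suc)
  have loops: "H i \<in> ec_loops X \<kappa> x0" if "i \<le> k" for i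
    using that step[of i] H0 g by (cases "i = k") (auto simp: loop_step_def)
  then have "\<forall>i\<in>{0..k}. \<exists>N. \<forall>n\<ge>N. H i n = x0"
    using ec_loopsD(4)[OF sym] by simp
  then obtain N where N: "\<And>i n. i \<le> k \<Longrightarrow> n \<ge> N i \<Longrightarrow> H i n = x0"
    by (metis atLeastAtMost_iff le0)
  \<comment> \<open>The maximum exists because there are only \<open>k + 1\<close> slices; the
    \<open>Suc\<close> makes the bound positive, as \<open>holds_endpoints_fixed\<close>
    demands.\<close>
  have bound: "H i n = x0" if "i \<le> k" "n \<ge> Suc (Max (N ` {0..k}))" for i n
  proof (rule N[OF \<open>i \<le> k\<close>])
    have "N i \<le> Max (N ` {0..k})"
      using that by (intro Max_ge) auto
    with that show "N i \<le> n"
      by linarith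
  qed
  have "holds_endpoints_fixed f g k H"
    unfolding holds_endpoints_fixed_def
  proof (intro conjI exI[of _ "Suc (Max (N ` {0..k}))"] ballI allI impI)
    fix s assume "s \<in> {0..k}"
    then show "H s 0 = f 0" "f 0 = g 0"
      using loops[of s] ec_loopsD(3)[OF sym, of _ x0] f g by (metis atLeastAtMost_iff)+
  next
    fix n s assume "Suc (Max (N ` {0..k})) \<le> n" "s \<in> {0..k}"
    then have "H s n = x0" "f n = x0" "g n = x0"
      using bound[of s n] bound[of 0 n] bound[of k n] H0 by simp_all
    then show "H s n = f n" "f n = g n"
      by simp_all
  qed simp
  moreover have "ec_homotopy X \<kappa> f g k H"
    unfolding ec_homotopy_def dig_homotopy_def dig_continuous_atLeastAtMost_iff[OF sym]
  proof (intro conjI ballI allI impI)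
    have path: "dig_continuous UNIV consec X \<kappa> h" "ec_path X \<kappa> h" if "h \<in> ec_loops X \<kappa> x0" for h
      using that by (simp_all add: ec_loops_def ec_path_def)
    show "dig_continuous UNIV consec X \<kappa> f" "dig_continuous UNIV consec X \<kappa> g"
      using f g by (simp_all add: path)
    fix s
    show "dig_continuous UNIV consec X \<kappa> (H s)" "ec_path X \<kappa> (H s)" if "s \<in> {0..k}"
      using that loops by (simp_all add: path)
    fix n
    show "H s n \<in> X" if "s \<le> k"
      using ec_loopsD(1)[OF sym loops[OF that]] .
    show "\<kappa>\<^sup>=\<^sup>= (H s n) (H (Suc s) n)" if "s < k"
      using step[OF that] by (simp add: loop_step_def)
  qed (use k H0 in simp_all)
  ultimately show "(f, g) \<in> ec_loop_rel X \<kappa> x0"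
    using f g by (auto simp: ec_loop_rel_def)
qed

text \<open>Reflexivity and transitivity are those of the closure; symmetry holds because every
  single link can be reversed.\<close>

lemma equiv_ec_loop_rel:
  assumes sym: "symp_on X \<kappa>"
  shows "equiv (ec_loops X \<kappa> x0) (ec_loop_rel X \<kappa> x0)"
proof (rule equivI)
  show "ec_loop_rel X \<kappa> x0 \<subseteq> ec_loops X \<kappa> x0 \<times> ec_loops X \<kappa> x0"
    by (auto simp: ec_loop_rel_def)
  show "refl_on (ec_loops X \<kappa> x0) (ec_loop_rel X \<kappa> x0)"
    by (auto simp: refl_on_def ec_loop_rel_iff[OF sym])
  have "symp (loop_step X \<kappa> x0)"
    unfolding symp_def loop_step_def
  proof (intro allI impI conjI; elim conjE)
    fix f g n
    assume "f \<in> ec_loops X \<kappa> x0" "g \<in> ec_loops X \<kappa> x0" "\<forall>n. \<kappa>\<^sup>=\<^sup>= (f n) (g n)"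
    then show "\<kappa>\<^sup>=\<^sup>= (g n) (f n)"
      using ec_loopsD(1)[OF sym] by - (rule reflclp_sym[OF sym], simp_all)
  qed
  then have "symp (loop_step X \<kappa> x0)\<^sup>*\<^sup>*"
    by (rule symp_rtranclp)
  then show "sym (ec_loop_rel X \<kappa> x0)"
    by (auto simp: sym_def ec_loop_rel_iff[OF sym] rtranclp_loop_step_in_loops dest: sympD)
  show "trans (ec_loop_rel X \<kappa> x0)"
    by (auto simp: trans_def ec_loop_rel_iff[OF sym])
qed

lemma
  assumes "symp_on X \<kappa>"
  shows sym_ec_loop_rel: "sym (ec_loop_rel X \<kappa> x0)"
    and trans_ec_loop_rel: "trans (ec_loop_rel X \<kappa> x0)"
  using equiv_ec_loop_rel[OF assms, of x0] by (simp_all add: equiv_def)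

section \<open>Concatenation and its compatibility with homotopy\<close>

text \<open>
  The stopping time is invariant neither under homotopy nor under composition with a map, so
  concatenations are compared at a common later switching time \<open>m\<close>.
\<close>

definition concat_at :: "nat \<Rightarrow> (nat \<Rightarrow> 'a) \<Rightarrow> (nat \<Rightarrow> 'a) \<Rightarrow> nat \<Rightarrow> 'a" where
  "concat_at m f g n = (if n \<le> m then f n else g (n - m))"

lemma ec_concat_eq: "ec_concat f g = concat_at (ec_stop f) f g"
  by (auto simp: ec_concat_def concat_at_def)

text \<open>The minimum in \<open>ec_stop\<close> is attained since a loop is eventually constant;
  comparison with a late index identifies the constant as \<open>x0\<close>.\<close>

lemma ec_stop_loop:
  assumes "symp_on X \<kappa>" "f \<in> ec_loops X \<kappa> x0" "n \<ge> ec_stop f"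
  shows "f n = x0"
proof -
  obtain N where N: "\<And>n. n \<ge> N \<Longrightarrow> f n = x0"
    using ec_loopsD(4)[OF assms(1,2)] by blast
  then have "\<forall>n\<ge>N. f n = f N"
    by simp
  then have "\<forall>n\<ge>ec_stop f. f n = f (ec_stop f)"
    unfolding ec_stop_def by (rule LeastI)
  then show ?thesis
    using N assms(3) by (metis nle_le)
qed

text \<open>The delicate point is the junction: \<open>f m\<close> and \<open>g 0\<close> are both
  the base point, so the step from \<open>m\<close> to \<open>m + 1\<close> is the first step of
  \<open>g\<close>.\<close>

lemma concat_at_in_loops:
  assumes sym: "symp_on X \<kappa>"
    and f: "f \<in> ec_loops X \<kappa> x0" and g: "g \<in> ec_loops X \<kappa> x0" and m: "f m = x0"
  shows "concat_at m f g \<in> ec_loops X \<kappa> x0"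
proof -
  obtain N where N: "\<And>n. n \<ge> N \<Longrightarrow> g n = x0"
    using ec_loopsD(4)[OF sym g] by blast
  have "\<kappa>\<^sup>=\<^sup>= (concat_at m f g n) (concat_at m f g (Suc n))" for n
  proof (cases "n \<le> m")
    case True
    then show ?thesis
      using ec_loopsD(2)[OF sym f, of n] ec_loopsD(2)[OF sym g, of 0] ec_loopsD(3)[OF sym g] m
      by (cases "n = m") (simp_all add: concat_at_def)
  next
    case False
    then show ?thesis
      using ec_loopsD(2)[OF sym g, of "n - m"] by (simp add: concat_at_def Suc_diff_le)
  qed
  moreover have "concat_at m f g n = x0" if "n \<ge> Suc (m + N)" for n
    using that N by (simp add: concat_at_def)
  moreover have "concat_at m f g n \<in> X" "concat_at m f g 0 = x0" for n
    using ec_loopsD(1,3)[OF sym f] ec_loopsD(1)[OF sym g] by (simp_all add: concat_at_def)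
  ultimately show ?thesis
    unfolding ec_loops_iff[OF sym] by blast
qed

text \<open>Delaying the switch by one replaces each value of \<open>g\<close> after the switch by
  its predecessor, which is equal or adjacent to it. Each unit of delay is therefore one
  link.\<close>

lemma concat_at_later:
  assumes sym: "symp_on X \<kappa>"
    and f: "f \<in> ec_loops X \<kappa> x0" and g: "g \<in> ec_loops X \<kappa> x0"
    and stop: "\<And>n. n \<ge> m \<Longrightarrow> f n = x0" and "m \<le> m'"
  shows "(concat_at m f g, concat_at m' f g) \<in> ec_loop_rel X \<kappa> x0"
  using \<open>m \<le> m'\<close>
proof (induction m' rule: dec_induct)
  case base
  then show ?case
    using concat_at_in_loops[OF sym f g, of m] stop by (simp add: ec_loop_rel_iff[OF sym])
next
  case (step k)
  have "loop_step X \<kappa> x0 (concat_at k f g) (concat_at (Suc k) f g)"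
    unfolding loop_step_def
  proof (intro conjI allI)
    fix n
    have g': "\<And>i. g i \<in> X" "\<And>i. \<kappa>\<^sup>=\<^sup>= (g i) (g (Suc i))" "g 0 = x0"
      using ec_loopsD[OF sym g] by blast+
    consider "n \<le> k" | "n = Suc k" | i where "n = Suc k + Suc i"
      by (metis add_Suc_right less_imp_Suc_add not_less_eq_eq le_Suc_eq add_Suc not_le)
    then show "\<kappa>\<^sup>=\<^sup>= (concat_at k f g n) (concat_at (Suc k) f g n)"
    proof cases
      \<comment> \<open>Here the undelayed loop is already at \<open>g 1\<close>, while the delayed
        one still waits at \<open>f (Suc k)\<close>, which is \<open>x0\<close> and hence
        \<open>g 0\<close>.\<close>
      case 2
      have "\<kappa>\<^sup>=\<^sup>= (g 1) (g 0)"
        using g'(1,1) g'(2)[of 0] by - (rule reflclp_sym[OF sym], simp_all)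
      then show ?thesis
        using 2 g'(3) stop step.hyps by (simp add: concat_at_def)
    next
      case 3
      have "\<kappa>\<^sup>=\<^sup>= (g (Suc (Suc i))) (g (Suc i))"
        using g'(1,1) g'(2)[of "Suc i"] by - (rule reflclp_sym[OF sym], simp_all)
      then show ?thesis
        using 3 by (simp add: concat_at_def Suc_diff_le)
    qed (simp add: concat_at_def)
  qed (use stop step.hyps in \<open>auto intro!: concat_at_in_loops[OF sym f g]\<close>)
  with step.IH show ?case
    unfolding ec_loop_rel_iff[OF sym] by (auto intro: rtranclp.rtrancl_into_rtrancl)
qed

text \<open>The two stopping times may differ. Both concatenations are delayed to the later one,
  where they differ by a single link.\<close>

lemma ec_concat_loop_step_left:
  assumes sym: "symp_on X \<kappa>"
    and ff': "loop_step X \<kappa> x0 f f'" and g: "g \<in> ec_loops X \<kappa> x0"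
  shows "(ec_concat f g, ec_concat f' g) \<in> ec_loop_rel X \<kappa> x0"
proof -
  have f: "f \<in> ec_loops X \<kappa> x0" and f': "f' \<in> ec_loops X \<kappa> x0"
    using ff' by (auto simp: loop_step_def)
  define m where "m = max (ec_stop f) (ec_stop f')"
  have m: "f m = x0" "f' m = x0"
    using ec_stop_loop[OF sym] f f' by (auto simp: m_def)
  have "(ec_concat f g, concat_at m f g) \<in> ec_loop_rel X \<kappa> x0"
    unfolding ec_concat_eq
    by (rule concat_at_later[OF sym f g]) (auto simp: m_def ec_stop_loop[OF sym f])
  moreover have "loop_step X \<kappa> x0 (concat_at m f g) (concat_at m f' g)"
    using ff' f f' g m concat_at_in_loops[OF sym]
    by (auto simp: loop_step_def concat_at_def)
  moreover have "(concat_at m f' g, ec_concat f' g) \<in> ec_loop_rel X \<kappa> x0"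
    unfolding ec_concat_eq
    by (rule symD[OF sym_ec_loop_rel[OF sym]], rule concat_at_later[OF sym f' g])
      (auto simp: m_def ec_stop_loop[OF sym f'])
  ultimately show ?thesis
    unfolding ec_loop_rel_iff[OF sym]
    by (meson converse_rtranclp_into_rtranclp rtranclp_trans)
qed

text \<open>Both concatenations switch at the stopping time of \<open>f\<close>, so one link is
  enough.\<close>

lemma ec_concat_loop_step_right:
  assumes sym: "symp_on X \<kappa>"
    and f: "f \<in> ec_loops X \<kappa> x0" and gg': "loop_step X \<kappa> x0 g g'"
  shows "(ec_concat f g, ec_concat f g') \<in> ec_loop_rel X \<kappa> x0"
proof -
  have m: "f (ec_stop f) = x0"
    using ec_stop_loop[OF sym f] by simp
  then have "loop_step X \<kappa> x0 (ec_concat f g) (ec_concat f g')"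
    using gg' f concat_at_in_loops[OF sym]
    unfolding ec_concat_eq by (auto simp: loop_step_def concat_at_def)
  then show ?thesis
    unfolding ec_loop_rel_iff[OF sym] by (auto simp: loop_step_def)
qed

text \<open>One factor is moved along its chain at a time, first the left one and then the right
  one.\<close>

lemma ec_concat_congruent:
  assumes sym: "symp_on X \<kappa>"
    and ff': "(f, f') \<in> ec_loop_rel X \<kappa> x0" and gg': "(g, g') \<in> ec_loop_rel X \<kappa> x0"
  shows "(ec_concat f g, ec_concat f' g') \<in> ec_loop_rel X \<kappa> x0"
proof -
  note trans = transD[OF trans_ec_loop_rel[OF sym]]
  have f: "f \<in> ec_loops X \<kappa> x0" and f': "f' \<in> ec_loops X \<kappa> x0" and g: "g \<in> ec_loops X \<kappa> x0"
    using ff' gg' by (auto simp: ec_loop_rel_def)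
  have base: "(ec_concat h g, ec_concat h g) \<in> ec_loop_rel X \<kappa> x0" if "h \<in> ec_loops X \<kappa> x0" for h
    using concat_at_in_loops[OF sym that g] ec_stop_loop[OF sym that]
    by (simp add: ec_loop_rel_iff[OF sym] ec_concat_eq)
  have "(loop_step X \<kappa> x0)\<^sup>*\<^sup>* f f'" "(loop_step X \<kappa> x0)\<^sup>*\<^sup>* g g'"
    using ff' gg' by (auto simp: ec_loop_rel_iff[OF sym])
  from this(1) have "(ec_concat f g, ec_concat f' g) \<in> ec_loop_rel X \<kappa> x0"
    by (induction rule: rtranclp_induct)
      (use base f in \<open>auto intro: trans ec_concat_loop_step_left[OF sym _ g]\<close>)
  moreover from \<open>(loop_step X \<kappa> x0)\<^sup>*\<^sup>* g g'\<close>
  have "(ec_concat f' g, ec_concat f' g') \<in> ec_loop_rel X \<kappa> x0"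
    by (induction rule: rtranclp_induct)
      (use base f' in \<open>auto intro: trans ec_concat_loop_step_right[OF sym f']\<close>)
  ultimately show ?thesis
    by (rule trans)
qed

text \<open>By congruence all members of the union that defines the product are the same
  class.\<close>

lemma ec_mult_class:
  assumes sym: "symp_on X \<kappa>"
    and f: "f \<in> ec_loops X \<kappa> x0" and g: "g \<in> ec_loops X \<kappa> x0"
  shows "ec_loop_rel X \<kappa> x0 `` {f} \<otimes>\<^bsub>ec_fundamental_group X \<kappa> x0\<^esub> ec_loop_rel X \<kappa> x0 `` {g} =
    ec_loop_rel X \<kappa> x0 `` {ec_concat f g}"
proof -
  note equiv = equiv_ec_loop_rel[OF sym, of x0]
  have "ec_loop_rel X \<kappa> x0 `` {ec_concat f' g'} = ec_loop_rel X \<kappa> x0 `` {ec_concat f g}"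
    if "(f, f') \<in> ec_loop_rel X \<kappa> x0" "(g, g') \<in> ec_loop_rel X \<kappa> x0" for f' g'
    using equiv_class_eq[OF equiv ec_concat_congruent[OF sym that]] by simp
  moreover have "(f, f) \<in> ec_loop_rel X \<kappa> x0" "(g, g) \<in> ec_loop_rel X \<kappa> x0"
    using f g by (auto simp: ec_loop_rel_iff[OF sym])
  ultimately have "(\<Union>f'\<in>ec_loop_rel X \<kappa> x0 `` {f}. \<Union>g'\<in>ec_loop_rel X \<kappa> x0 `` {g}.
      ec_loop_rel X \<kappa> x0 `` {ec_concat f' g'}) = ec_loop_rel X \<kappa> x0 `` {ec_concat f g}"
    by blast
  then show ?thesis
    by (simp add: ec_fundamental_group_def)
qed

section \<open>Loops under continuous maps\<close>

lemma loop_map: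
  assumes symX: "symp_on X \<kappa>" and symY: "symp_on Y lam"
    and h: "dig_continuous X \<kappa> Y lam h" and "h x0 = y0"
    and a: "a \<in> ec_loops X \<kappa> x0"
  shows "h \<circ> a \<in> ec_loops Y lam y0"
proof -
  have hX: "\<And>x. x \<in> X \<Longrightarrow> h x \<in> Y" "\<And>x y. x \<in> X \<Longrightarrow> y \<in> X \<Longrightarrow> \<kappa>\<^sup>=\<^sup>= x y \<Longrightarrow> lam\<^sup>=\<^sup>= (h x) (h y)"
    using h unfolding dig_continuous_iff[OF symX] by auto
  show ?thesis
    using ec_loopsD[OF symX a] \<open>h x0 = y0\<close> hX unfolding ec_loops_iff[OF symY] comp_def
    by metis
qed

lemma ec_loop_rel_map:
  assumes symX: "symp_on X \<kappa>" and symY: "symp_on Y lam"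
    and h: "dig_continuous X \<kappa> Y lam h" and hx: "h x0 = y0"
    and ab: "(a, b) \<in> ec_loop_rel X \<kappa> x0"
  shows "(h \<circ> a, h \<circ> b) \<in> ec_loop_rel Y lam y0"
proof -
  note map = loop_map[OF symX symY h hx]
  have map_step: "loop_step Y lam y0 (h \<circ> u) (h \<circ> v)" if uv: "loop_step X \<kappa> x0 u v" for u v
    unfolding loop_step_def
  proof (intro conjI allI)
    have u: "u n \<in> X" and v: "v n \<in> X" and "\<kappa>\<^sup>=\<^sup>= (u n) (v n)" for n
      using uv ec_loopsD(1)[OF symX] by (auto simp: loop_step_def)
    then show "lam\<^sup>=\<^sup>= ((h \<circ> u) n) ((h \<circ> v) n)" for n
      using h unfolding dig_continuous_iff[OF symX] comp_def by (metis sup2E sup2I1 sup2I2)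
  qed (use uv map in \<open>auto simp: loop_step_def\<close>)
  have "(loop_step X \<kappa> x0)\<^sup>*\<^sup>* a b"
    using ab by (simp add: ec_loop_rel_iff[OF symX])
  then have "(loop_step Y lam y0)\<^sup>*\<^sup>* (h \<circ> a) (h \<circ> b)"
  proof (induction rule: rtranclp_induct)
    case (step u v)
    then show ?case
      using map_step rtranclp.rtrancl_into_rtrancl[of "loop_step Y lam y0" "h \<circ> a" "h \<circ> u"] by blast
  qed simp
  moreover have "h \<circ> a \<in> ec_loops Y lam y0"
    using ab map by (auto simp: ec_loop_rel_def)
  ultimately show ?thesis
    by (simp add: ec_loop_rel_iff[OF symY])
qed

text \<open>The map \<open>h\<close> may collapse the tail of \<open>a\<close>, so
  \<open>h \<circ> a\<close> can stop earlier than \<open>a\<close>. The two sides then differ only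
  in the switching time, and waiting at the base point relates them.\<close>

lemma ec_loop_rel_map_concat:
  assumes symX: "symp_on X \<kappa>" and symY: "symp_on Y lam"
    and h: "dig_continuous X \<kappa> Y lam h" and hx: "h x0 = y0"
    and a: "a \<in> ec_loops X \<kappa> x0" and b: "b \<in> ec_loops X \<kappa> x0"
  shows "(ec_concat (h \<circ> a) (h \<circ> b), h \<circ> ec_concat a b) \<in> ec_loop_rel Y lam y0"
proof -
  note map = loop_map[OF symX symY h hx]
  have "h \<circ> ec_concat a b = concat_at (ec_stop a) (h \<circ> a) (h \<circ> b)"
    by (auto simp: ec_concat_eq concat_at_def)
  moreover have "ec_stop (h \<circ> a) \<le> ec_stop a"
    unfolding ec_stop_def[of "h \<circ> a"]
    by (rule Least_le) (simp add: ec_stop_loop[OF symX a])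
  moreover have "(concat_at (ec_stop (h \<circ> a)) (h \<circ> a) (h \<circ> b),
      concat_at m (h \<circ> a) (h \<circ> b)) \<in> ec_loop_rel Y lam y0" if "ec_stop (h \<circ> a) \<le> m" for m
    by (rule concat_at_later[OF symY map[OF a] map[OF b] ec_stop_loop[OF symY map[OF a]] that])
  ultimately show ?thesis
    by (simp only: ec_concat_eq[of "h \<circ> a"])
qed

section \<open>Long homotopies along a loop\<close>

text \<open>The slices of the long homotopy between two sufficiently distant times, composed with
  \<open>a\<close>, form a chain of loops; the fixed base point makes them loops at
  \<open>y0\<close>.\<close>

lemma pointed_long_homotopic_loop:
  assumes symX: "symp_on X \<kappa>" and symY: "symp_on Y lam"
    and "pointed_long_homotopic X \<kappa> x0 Y lam y0 p q"
    and a: "a \<in> ec_loops X \<kappa> x0"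
  shows "(p \<circ> a, q \<circ> a) \<in> ec_loop_rel Y lam y0"
proof -
  obtain F where F: "long_homotopy X \<kappa> Y lam p q F" and F0: "\<And>t. F x0 t = y0"
    using assms(3) by (auto simp: pointed_long_homotopic_def)
  have aX: "a n \<in> X" for n
    using ec_loopsD(1)[OF symX a] .
  have "\<forall>x\<in>X. \<exists>N::nat. (\<forall>t \<le> - int N. F x t = p x) \<and> (\<forall>t \<ge> int N. F x t = q x)"
    using F unfolding long_homotopy_def by meson
  then obtain N :: "_ \<Rightarrow> nat"
    where N: "\<And>x t. x \<in> X \<Longrightarrow> t \<le> - int (N x) \<Longrightarrow> F x t = p x"
      "\<And>x t. x \<in> X \<Longrightarrow> t \<ge> int (N x) \<Longrightarrow> F x t = q x"
    by metis
  \<comment> \<open>This is where eventual constancy enters: \<open>a\<close> takes finitely many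
    values, so the pointwise bounds \<open>N\<close> have a maximum along it.\<close>
  have "range a \<subseteq> insert x0 (a ` {..ec_stop a})"
    using ec_stop_loop[OF symX a] by (auto simp: image_iff) (metis atMost_iff nle_le)
  then have fin: "finite (range (N \<circ> a))"
    by (metis finite.emptyI finite_atMost finite_imageI finite_insert finite_subset image_comp)
  define M where "M = Max (range (N \<circ> a))"
  have M: "N (a n) \<le> M" for n
    unfolding M_def using Max_ge[OF fin, of "N (a n)"] by auto
  \<comment> \<open>The integer times from \<open>-M\<close> to \<open>M\<close> are shifted to the
    natural numbers from 0 to \<open>2 * M\<close>. For \<open>M = 0\<close> the chain is empty and
    \<open>p \<circ> a\<close> equals \<open>q \<circ> a\<close>.\<close>
  define H where "H s n = F (a n) (int s - int M)" for s n
  have "H s \<in> ec_loops Y lam y0" for s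
  proof -
    have "H s = (\<lambda>x. F x (int s - int M)) \<circ> a"
      by (simp add: H_def fun_eq_iff)
    moreover have "dig_continuous X \<kappa> Y lam (\<lambda>x. F x (int s - int M))"
      using F unfolding long_homotopy_def by blast
    ultimately show ?thesis
      using loop_map[OF symX symY, where h = "\<lambda>x. F x (int s - int M)", OF _ F0 a] by simp
  qed
  moreover have "lam\<^sup>=\<^sup>= (H s n) (H (Suc s) n)" for s n
  proof -
    have "dig_continuous UNIV consec Y lam (F (a n))"
      using F aX by (auto simp: long_homotopy_def)
    moreover have "consec (int s - int M) (int (Suc s) - int M)"
      by (simp add: consec_def)
    ultimately show ?thesis
      unfolding dig_continuous_iff[OF symp_on_consec] H_def by blast
  qed
  ultimately have "(loop_step Y lam y0)\<^sup>*\<^sup>* (H 0) (H (2 * M))" "H 0 \<in> ec_loops Y lam y0"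
    using loop_step_chain[of "2 * M" H Y lam y0] by blast+
  moreover have "H 0 = p \<circ> a" "H (2 * M) = q \<circ> a"
    using M by (auto simp: H_def fun_eq_iff intro!: N aX)
  ultimately show ?thesis
    by (simp add: ec_loop_rel_iff[OF symY])
qed

section \<open>Induced homomorphisms and the isomorphism\<close>

text \<open>Closing the image under the relation avoids a choice of representative.\<close>

definition induced_map ::
  "'b set \<Rightarrow> ('b \<Rightarrow> 'b \<Rightarrow> bool) \<Rightarrow> 'b \<Rightarrow> ('a \<Rightarrow> 'b) \<Rightarrow> (nat \<Rightarrow> 'a) set \<Rightarrow> (nat \<Rightarrow> 'b) set" where
  "induced_map Y lam y0 h A = ec_loop_rel Y lam y0 `` ((\<circ>) h ` A)"

text \<open>Related loops have related images, so the whole image of the class lies in one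
  class.\<close>

lemma induced_map_class:
  assumes symX: "symp_on X \<kappa>" and symY: "symp_on Y lam"
    and h: "dig_continuous X \<kappa> Y lam h" and hx: "h x0 = y0"
    and a: "a \<in> ec_loops X \<kappa> x0"
  shows "induced_map Y lam y0 h (ec_loop_rel X \<kappa> x0 `` {a}) = ec_loop_rel Y lam y0 `` {h \<circ> a}"
proof -
  have "ec_loop_rel Y lam y0 `` {h \<circ> b} = ec_loop_rel Y lam y0 `` {h \<circ> a}"
    if "(a, b) \<in> ec_loop_rel X \<kappa> x0" for b
    using equiv_class_eq[OF equiv_ec_loop_rel[OF symY] ec_loop_rel_map[OF symX symY h hx that]]
    by simp
  moreover have "(a, a) \<in> ec_loop_rel X \<kappa> x0"
    using a by (auto simp: ec_loop_rel_iff[OF symX])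
  ultimately show ?thesis
    unfolding induced_map_def by blast
qed

lemma carrier_ec_fundamental_group:
  "carrier (ec_fundamental_group X \<kappa> x0) = ec_loops X \<kappa> x0 // ec_loop_rel X \<kappa> x0"
  by (simp add: ec_fundamental_group_def)

lemma induced_map_hom:
  assumes symX: "symp_on X \<kappa>" and symY: "symp_on Y lam"
    and h: "dig_continuous X \<kappa> Y lam h" and hx: "h x0 = y0"
  shows "induced_map Y lam y0 h \<in> hom (ec_fundamental_group X \<kappa> x0) (ec_fundamental_group Y lam y0)"
proof (rule homI)
  note map = loop_map[OF symX symY h hx]
  note cls = induced_map_class[OF symX symY h hx]
  fix A assume "A \<in> carrier (ec_fundamental_group X \<kappa> x0)"
  then obtain a where a: "a \<in> ec_loops X \<kappa> x0" "A = ec_loop_rel X \<kappa> x0 `` {a}"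
    by (auto simp: carrier_ec_fundamental_group elim: quotientE)
  then show "induced_map Y lam y0 h A \<in> carrier (ec_fundamental_group Y lam y0)"
    by (simp add: carrier_ec_fundamental_group cls map quotientI)
  fix B assume "B \<in> carrier (ec_fundamental_group X \<kappa> x0)"
  then obtain b where b: "b \<in> ec_loops X \<kappa> x0" "B = ec_loop_rel X \<kappa> x0 `` {b}"
    by (auto simp: carrier_ec_fundamental_group elim: quotientE)
  have "ec_concat a b \<in> ec_loops X \<kappa> x0"
    unfolding ec_concat_eq
    using concat_at_in_loops[OF symX a(1) b(1)] ec_stop_loop[OF symX a(1)] by simp
  then show "induced_map Y lam y0 h (A \<otimes>\<^bsub>ec_fundamental_group X \<kappa> x0\<^esub> B) =
    induced_map Y lam y0 h A \<otimes>\<^bsub>ec_fundamental_group Y lam y0\<^esub> induced_map Y lam y0 h B"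
    using equiv_class_eq[OF equiv_ec_loop_rel[OF symY]
        ec_loop_rel_map_concat[OF symX symY h hx a(1) b(1)]]
    by (simp add: a b ec_mult_class[OF symX] ec_mult_class[OF symY] cls map)
qed

text \<open>The long homotopy places \<open>g \<circ> f \<circ> a\<close> in the class of
  \<open>a\<close>. Stated for one composite only, the lemma serves for both after exchanging the
  two images.\<close>

lemma induced_map_left_inverse:
  assumes symX: "symp_on X \<kappa>" and symY: "symp_on Y lam"
    and f: "dig_continuous X \<kappa> Y lam f" "f x0 = y0"
    and g: "dig_continuous Y lam X \<kappa> g" "g y0 = x0"
    and homotopic: "pointed_long_homotopic X \<kappa> x0 X \<kappa> x0 (g \<circ> f) id"
    and A: "A \<in> carrier (ec_fundamental_group X \<kappa> x0)"
  shows "induced_map X \<kappa> x0 g (induced_map Y lam y0 f A) = A"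
proof -
  obtain a where a: "a \<in> ec_loops X \<kappa> x0" "A = ec_loop_rel X \<kappa> x0 `` {a}"
    using A by (auto simp: carrier_ec_fundamental_group elim: quotientE)
  have "(g \<circ> f \<circ> a, id \<circ> a) \<in> ec_loop_rel X \<kappa> x0"
    by (rule pointed_long_homotopic_loop[OF symX symX homotopic a(1)])
  then show ?thesis
    using equiv_class_eq[OF equiv_ec_loop_rel[OF symX]]
    by (simp add: a induced_map_class[OF symX symY f] induced_map_class[OF symY symX g]
        loop_map[OF symX symY f] comp_assoc)
qed

theorem theorem7p3:
  fixes X :: "(int ^ 'n::finite) set" and \<kappa> :: "int ^ 'n \<Rightarrow> int ^ 'n \<Rightarrow> bool"
    and Y :: "(int ^ 'm::finite) set" and lam :: "int ^ 'm \<Rightarrow> int ^ 'm \<Rightarrow> bool"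
    and x0 :: "int ^ 'n" and y0 :: "int ^ 'm"
  assumes "digital_image X \<kappa>" and "digital_image Y lam"
    and "x0 \<in> X" and "y0 \<in> Y"
    and "same_pointed_long_homotopy_type X \<kappa> x0 Y lam y0"
  shows "ec_fundamental_group X \<kappa> x0 \<cong> ec_fundamental_group Y lam y0"
proof -
  have symX: "symp_on X \<kappa>" and symY: "symp_on Y lam"
    using assms by (auto simp: digital_image_def)
  obtain f g where f: "dig_continuous X \<kappa> Y lam f" "f x0 = y0"
    and g: "dig_continuous Y lam X \<kappa> g" "g y0 = x0"
    and gf: "pointed_long_homotopic X \<kappa> x0 X \<kappa> x0 (g \<circ> f) id"
    and fg: "pointed_long_homotopic Y lam y0 Y lam y0 (f \<circ> g) id"
    using assms(5) unfolding same_pointed_long_homotopy_type_def by blast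
  note homf = induced_map_hom[OF symX symY f] and homg = induced_map_hom[OF symY symX g]
  have "bij_betw (induced_map Y lam y0 f)
    (carrier (ec_fundamental_group X \<kappa> x0)) (carrier (ec_fundamental_group Y lam y0))"
  proof (rule bij_betwI)
    show "induced_map Y lam y0 f \<in> carrier (ec_fundamental_group X \<kappa> x0) \<rightarrow> carrier (ec_fundamental_group Y lam y0)"
      using homf by (simp add: hom_def)
    show "induced_map X \<kappa> x0 g \<in> carrier (ec_fundamental_group Y lam y0) \<rightarrow> carrier (ec_fundamental_group X \<kappa> x0)"
      using homg by (simp add: hom_def)
  qed (simp_all add: induced_map_left_inverse[OF symX symY f g gf]
      induced_map_left_inverse[OF symY symX g f fg])
  with homf show ?thesis
    by (auto simp: is_iso_def iso_def)
qed

end
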